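(* Let $\alpha<1$ and $\beta>1$ be real numbers and let $f\in\mathcal{A}$. If $f\in\mathcal{S}(\alpha,\beta)$, then $$\log\left\{\frac{f(z)}{z}\right\}\prec \widehat{P}_{\alpha,\beta}(z)\quad(z\in\Delta),$$ where $$\widehat{P}_{\alpha,\beta}(z):=\int_{0}^{z}\frac{P_{\alpha,\beta}(t)-1}{t}\,{\rm d}t,$$ and, moreover, $\widehat{P}_{\alpha,\beta}$ is convex univalent in $\Delta$.
   Context: $\Delta=\{z\in\mathbb{C}:|z|<1\}$ is the open unit disc. $\mathcal{A}$ is the class of functions $f$ analytic in $\Delta$ with $f(0)=0$ and $f'(0)=1$. For real $\alpha<1$ and $\beta>1$, $\mathcal{S}(\alpha,\beta)$ is the class of all $f\in\mathcal{A}$ such that $\alpha<\mathrm{Re}\{zf'(z)/f(z)\}<\beta$ for all $z\in\Delta$. Here $zf'(z)/f(z)$ is analytic in $\Delta$ with value $1$ at $z=0$; in particular $f(z)\neq0$ for $z\in\Delta\setminus\{0\}$. For $f$ in this class, $f(z)/z$ (with value $1$ at $z=0$) is analytic and zero-free in $\Delta$, and $\log\{f(z)/z\}$ denotes its analytic logarithm on $\Delta$ with value $0$ at $z=0$. The function $P_{\alpha,\beta}$ is defined on $\Delta$ by $$P_{\alpha,\beta}(z):=1+\frac{\beta-\alpha}{\pi}\,i\,\log\left(\frac{1-e^{2\pi i\frac{1-\alpha}{\beta-\alpha}}z}{1-z}\right),$$ with the branch of the logarithm that vanishes at $z=0$. Subordination: for $g,h$ analytic in $\Delta$, $g\prec h$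 means that there is an analytic $\omega:\Delta\to\Delta$ with $\omega(0)=0$ and $g(z)=h(\omega(z))$ for all $z\in\Delta$. An analytic function on $\Delta$ is called convex univalent if it is injective on $\Delta$ and its image is a convex set. *)

theory Defs
  imports "HOL-Complex_Analysis.Complex_Analysis"
begin

abbreviation unit_disc :: "complex set"
  where "unit_disc \<equiv> ball 0 1"

definition normalized_class :: "(complex \<Rightarrow> complex) set"
  where "normalized_class =
    {f. f holomorphic_on unit_disc \<and> f 0 = 0 \<and> deriv f 0 = 1}"

text \<open>The quotient \<open>z f'(z) / f(z)\<close>, with its removable singularity at the origin filled in.\<close>

definition zf'_over_f :: "(complex \<Rightarrow> complex) \<Rightarrow> complex \<Rightarrow> complex"
  where "zf'_over_f f z = (if z = 0 then 1 else z * deriv f z / f z)"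

text \<open>
  The nonvanishing of \<^term>\<open>f\<close> off the origin is implicit in the requirement that
  \<open>z f'(z) / f(z)\<close> be analytic; it has to be stated because division by zero yields \<open>0\<close> in HOL.
\<close>

definition class_S :: "real \<Rightarrow> real \<Rightarrow> (complex \<Rightarrow> complex) set"
  where "class_S \<alpha> \<beta> =
    {f \<in> normalized_class.
       (\<forall>z\<in>unit_disc - {0}. f z \<noteq> 0) \<and>
       (\<forall>z\<in>unit_disc. \<alpha> < Re (zf'_over_f f z) \<and> Re (zf'_over_f f z) < \<beta>)}"

text \<open>
  The analytic logarithm on the unit disc, vanishing at the origin, of a zero-free analytic function
  with value \<open>1\<close> at the origin. It is in general not the principal branch \<^term>\<open>Ln\<close> applied to
  the function. The last conjunct only fixes the irrelevant values outside the disc, so that the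
  description is unique.
\<close>

definition disc_log :: "(complex \<Rightarrow> complex) \<Rightarrow> complex \<Rightarrow> complex"
  where "disc_log h =
    (THE g. g holomorphic_on unit_disc \<and> g 0 = 0 \<and>
            (\<forall>z\<in>unit_disc. exp (g z) = h z) \<and> (\<forall>z. z \<notin> unit_disc \<longrightarrow> g z = 0))"

lemma disc_log_unique:
  assumes g: "g holomorphic_on unit_disc" "g 0 = 0" "\<And>z. z \<in> unit_disc \<Longrightarrow> exp (g z) = h z"
      and k: "k holomorphic_on unit_disc" "k 0 = 0" "\<And>z. z \<in> unit_disc \<Longrightarrow> exp (k z) = h z"
      and z: "z \<in> unit_disc"
  shows "g z = k z"
proof -
  define d where "d = (\<lambda>z. g z - k z)"
  have hol: "d holomorphic_on unit_disc"
    unfolding d_def by (intro holomorphic_intros g k)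
  have exp_d: "exp (d w) = 1" if "w \<in> unit_disc" for w
    using g(3)[OF that] k(3)[OF that] exp_not_eq_zero[of "k w"] by (simp add: d_def exp_diff)
  have "(d has_field_derivative 0) (at w)" if w: "w \<in> unit_disc" for w
  proof -
    have D: "(d has_field_derivative deriv d w) (at w)"
      using hol w by (simp add: holomorphic_derivI)
    have "((\<lambda>w. exp (d w)) has_field_derivative exp (d w) * deriv d w) (at w)"
      using D by (auto intro!: derivative_eq_intros)
    moreover have "((\<lambda>w. exp (d w)) has_field_derivative 0) (at w)"
      by (rule has_field_derivative_transform_within_open[where f = "\<lambda>_. 1" and S = unit_disc])
         (use w in \<open>auto simp: exp_d\<close>)
    ultimately have "exp (d w) * deriv d w = 0"
      using DERIV_unique by blast
    then show ?thesis using D by simp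
  qed
  then have "d constant_on unit_disc"
    by (intro has_field_derivative_0_imp_constant_on) auto
  then have "d z = d 0"
    using z unfolding constant_on_def by (metis centre_in_ball zero_less_one)
  then show ?thesis by (simp add: d_def g k)
qed

lemma disc_log:
  assumes h: "h holomorphic_on unit_disc" "\<And>z. z \<in> unit_disc \<Longrightarrow> h z \<noteq> 0" "h 0 = 1"
  shows "disc_log h holomorphic_on unit_disc"
    and "disc_log h 0 = 0"
    and "\<And>z. z \<in> unit_disc \<Longrightarrow> exp (disc_log h z) = h z"
proof -
  let ?P = "\<lambda>g. g holomorphic_on unit_disc \<and> g 0 = 0 \<and>
            (\<forall>z\<in>unit_disc. exp (g z) = h z) \<and> (\<forall>z. z \<notin> unit_disc \<longrightarrow> g z = 0)"
  obtain g where g: "g holomorphic_on unit_disc" "\<And>z. z \<in> unit_disc \<Longrightarrow> h z = exp (g z)"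
    using contractible_imp_holomorphic_log[OF h(1) _ h(2)] convex_imp_contractible convex_ball
    by metis
  define k where "k = (\<lambda>z. if z \<in> unit_disc then g z - g 0 else 0)"
  have "(\<lambda>z. g z - g 0) holomorphic_on unit_disc"
    by (intro holomorphic_intros g)
  then have "k holomorphic_on unit_disc"
    by (rule holomorphic_transform) (simp add: k_def)
  moreover have "exp (g 0) = 1"
    using g(2)[of 0] h(3) by simp
  ultimately have "?P k"
    by (auto simp: k_def g(2) exp_diff)
  moreover have "k' = k" if "?P k'" for k'
  proof
    fix z show "k' z = k z"
      using that \<open>?P k\<close> disc_log_unique[of k' h k z] by (cases "z \<in> unit_disc") auto
  qed
  ultimately have "?P (disc_log h)"
    unfolding disc_log_def by (rule theI)
  then show "disc_log h holomorphic_on unit_disc" "disc_log h 0 = 0"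
    "\<And>z. z \<in> unit_disc \<Longrightarrow> exp (disc_log h z) = h z"
    by auto
qed

definition log_f_over_z :: "(complex \<Rightarrow> complex) \<Rightarrow> complex \<Rightarrow> complex"
  where "log_f_over_z f = disc_log (\<lambda>z. if z = 0 then 1 else f z / z)"

definition P_strip :: "real \<Rightarrow> real \<Rightarrow> complex \<Rightarrow> complex"
  where "P_strip \<alpha> \<beta> z =
    1 + of_real ((\<beta> - \<alpha>) / pi) * \<i> *
      disc_log (\<lambda>w. (1 - exp (2 * of_real pi * \<i> * of_real ((1 - \<alpha>) / (\<beta> - \<alpha>))) * w) / (1 - w)) z"

text \<open>
  The path runs along the segment from \<open>0\<close> to \<open>z\<close>; the value of the integrand at the single point
  \<open>t = 0\<close> (a removable singularity) does not affect the integral.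
\<close>

definition P_hat :: "real \<Rightarrow> real \<Rightarrow> complex \<Rightarrow> complex"
  where "P_hat \<alpha> \<beta> z = contour_integral (linepath 0 z) (\<lambda>t. (P_strip \<alpha> \<beta> t - 1) / t)"

definition subordinate :: "(complex \<Rightarrow> complex) \<Rightarrow> (complex \<Rightarrow> complex) \<Rightarrow> bool"  (infix "\<prec>" 50)
  where "g \<prec> h \<longleftrightarrow>
    g holomorphic_on unit_disc \<and> h holomorphic_on unit_disc \<and>
    (\<exists>\<omega>. \<omega> holomorphic_on unit_disc \<and> \<omega> ` unit_disc \<subseteq> unit_disc \<and> \<omega> 0 = 0 \<and>
         (\<forall>z\<in>unit_disc. g z = h (\<omega> z)))"

definition convex_univalent :: "(complex \<Rightarrow> complex) \<Rightarrow> bool"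
  where "convex_univalent g \<longleftrightarrow>
    g holomorphic_on unit_disc \<and> inj_on g unit_disc \<and> convex (g ` unit_disc)"

end

theory Submission
  imports Defs
begin

text \<open>
  Write \<open>\<phi> = P - 1\<close>, \<open>h\<close> for the integral of \<open>\<phi>(t) / t\<close>, and \<open>g = log (f(z) / z)\<close>. The function \<open>\<phi>\<close> maps
  the disc univalently onto a vertical strip containing \<open>0\<close>, \<open>z h' = \<phi>\<close>, and the hypothesis on \<open>f\<close> says that
  \<open>z g' = z f' / f - 1\<close> takes values in the strip.

  If \<open>h\<close> is univalent and \<open>z G'\<close> takes values in the convex set \<open>\<phi>(\<Delta>)\<close>, then \<open>G(\<Delta>) \<subseteq> h(\<Delta>)\<close> (Suffridge):
  otherwise Jack's lemma for \<open>h\<^sup>-\<^sup>1 \<circ> G\<close> at a first exit point gives \<open>z0 G'(z0) = m \<phi>(\<zeta>)\<close> with \<open>m \<ge> 1\<close> and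
  \<open>|\<zeta>| > |z0|\<close>, which contradicts Schwarz's lemma. With \<open>G = g\<close> this is the subordination; with
  \<open>G(z) = u h(c z) + v h(z)\<close> it shows that \<open>h(\<Delta>)\<close> is convex.

  Univalence of \<open>h\<close> holds because \<open>h' = \<phi>(z) / z\<close> lies in a half-plane. In the normalisation
  \<open>w = e\<^sup>i\<^sup>a z\<close>, this is the positivity of \<open>Re (i (Ln (1 - e\<^sup>i\<^sup>a w) - Ln (1 - e\<^sup>-\<^sup>i\<^sup>a w)) / w)\<close> for \<open>0 < a < \<pi>\<close>,
  and the derivative of this expression in \<open>a\<close> has the sign of \<open>cos a - Re w\<close>.
\<close>

section \<open>Subordination to univalent functions and Schwarz's lemma\<close>

text \<open>The Schwarz function is \<open>k \<circ> g\<close> with \<open>k\<close> the inverse of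
  \<open>h\<close>; it fixes \<open>0\<close> because \<open>g 0 = h 0\<close>.\<close>

lemma subordinate_univalentI:
  assumes h: "h holomorphic_on unit_disc" "inj_on h unit_disc"
    and g: "g holomorphic_on unit_disc" "g 0 = h 0" "g ` unit_disc \<subseteq> h ` unit_disc"
  shows "subordinate g h"
proof -
  obtain k where k: "k holomorphic_on (h ` unit_disc)"
    and kh: "\<And>z. z \<in> unit_disc \<Longrightarrow> k (h z) = z"
    using holomorphic_has_inverse[OF h(1) open_ball h(2)] by metis
  have "(k \<circ> g) holomorphic_on unit_disc"
    by (rule holomorphic_on_compose_gen[OF g(1) k g(3)])
  moreover have "k (g z) \<in> unit_disc \<and> g z = h (k (g z))" if "z \<in> unit_disc" for z
  proof -
    obtain w where "w \<in> unit_disc" "g z = h w"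
      using g(3) \<open>z \<in> unit_disc\<close> by blast
    then show ?thesis by (metis kh)
  qed
  moreover have "k (g 0) = 0"
    by (simp add: g kh)
  ultimately show ?thesis
    unfolding subordinate_def using g(1) h(1)
    by (intro conjI exI[of _ "k \<circ> g"]) (auto simp: image_subset_iff)
qed

text \<open>Schwarz's lemma for \<omega>; this control of moduli yields the contradiction in
  \<open>Suffridge_image_subset\<close>.\<close>

lemma subordinate_norm_le:
  assumes "subordinate g h" "z \<in> unit_disc"
  obtains w where "norm w \<le> norm z" "g z = h w"
proof -
  obtain \<omega> where \<omega>: "\<omega> holomorphic_on unit_disc" "\<omega> ` unit_disc \<subseteq> unit_disc" "\<omega> 0 = 0"
    and g: "\<forall>z\<in>unit_disc. g z = h (\<omega> z)"
    using assms(1) unfolding subordinate_def by blast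
  have "norm (\<omega> z) \<le> norm z"
    by (rule Schwarz_Lemma(1)[OF \<omega>(1,3)]) (use \<omega>(2) assms(2) in \<open>auto simp: image_subset_iff\<close>)
  then show ?thesis
    using g assms(2) that by blast
qed

lemma Schwarz_ball:
  fixes w :: "complex \<Rightarrow> complex"
  assumes w: "w holomorphic_on ball 0 R" "w 0 = 0" "\<And>z. norm z < R \<Longrightarrow> norm (w z) < \<rho>"
    and z: "norm z < R"
  shows "norm (w z) \<le> \<rho> * norm z / R"
proof -
  have "0 < R" using z norm_ge_zero le_less_trans by blast
  have "0 < \<rho>" using w(3)[OF z] norm_ge_zero le_less_trans by blast
  define v where "v = (\<lambda>\<zeta>. w (of_real R * \<zeta>) / of_real \<rho>)"
  have "norm (v (z / of_real R)) \<le> norm (z / of_real R)"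
  proof (rule Schwarz_Lemma(1))
    have "(\<lambda>\<zeta>. of_real R * \<zeta>) ` unit_disc \<subseteq> ball 0 R"
      using \<open>0 < R\<close> by (auto simp: norm_mult)
    then have "(w \<circ> (\<lambda>\<zeta>. of_real R * \<zeta>)) holomorphic_on unit_disc"
      by (intro holomorphic_on_compose_gen[OF _ w(1)] holomorphic_intros)
    then show "v holomorphic_on unit_disc"
      unfolding v_def o_def using \<open>0 < \<rho>\<close> by (intro holomorphic_intros) auto
    show "norm (v \<zeta>) < 1" if "norm \<zeta> < 1" for \<zeta>
      using w(3)[of "of_real R * \<zeta>"] that \<open>0 < R\<close> \<open>0 < \<rho>\<close>
      by (simp add: v_def norm_mult norm_divide)
  qed (use w(2) z \<open>0 < R\<close> in \<open>auto simp: v_def norm_divide\<close>)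
  then show ?thesis
    using \<open>0 < R\<close> \<open>0 < \<rho>\<close> by (simp add: v_def norm_divide field_simps)
qed

section \<open>Jack's lemma, Suffridge's theorem and convex images\<close>

text \<open>Put \<open>A = z0 * w' / w z0\<close>. Schwarz's bound is attained at \<open>z0\<close>,
  so moving inward gives \<open>Re (\<eta> * (A - 1)) \<le> 0\<close> whenever
  \<open>Re \<eta> < 0\<close>. For all such \<eta> this forces \<open>A\<close> to be real and at
  least \<open>1\<close>.\<close>

lemma Jack_lemma:
  fixes w :: "complex \<Rightarrow> complex"
  assumes w: "w holomorphic_on ball 0 R" "w 0 = 0" "\<And>z. norm z < R \<Longrightarrow> norm (w z) < \<rho>"
    and z0: "norm z0 = R" "R > 0" and w0: "norm (w z0) = \<rho>" "\<rho> > 0"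
    and D: "(w has_field_derivative w') (at z0)"
  obtains m :: real where "m \<ge> 1" "z0 * w' = of_real m * w z0"
proof -
  have "w z0 \<noteq> 0" "z0 \<noteq> 0" using w0 z0 by auto
  define A where "A = z0 * w' / w z0"
  \<comment> \<open>Compare \<open>w\<close> with the bound \<open>\<rho> |z| / R\<close> of Schwarz along the ray from \<open>z0\<close> in the inward direction
    \<open>z0 \<eta>\<close>; \<open>|x| \<le> (1 + x\<^sup>2) / 2\<close> replaces the modulus by a polynomial in the parameter.\<close>
  have key: "Re (\<eta> * A) \<le> Re \<eta>" if \<eta>: "Re \<eta> < 0" for \<eta>
  proof (rule ccontr)
    assume "\<not> ?thesis"
    then have neg: "Re \<eta> - Re (\<eta> * A) < 0" by simp
    define q where "q = (\<lambda>s::real. Re (w (z0 * (1 + of_real s * \<eta>)) / w z0))"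
    \<comment> \<open>\<open>v s\<close> is \<open>(1 + |1 + s \<eta>|^2) / 2 - q s\<close>. Its
      derivative at \<open>0\<close> would be negative, while Schwarz's bound makes it nonnegative
      for small \<open>s > 0\<close>.\<close>
    define v where "v = (\<lambda>s::real. 1 + s * Re \<eta> + s\<^sup>2 * (norm \<eta>)\<^sup>2 / 2 - q s)"
    have "((\<lambda>s::real. w (z0 * (1 + of_real s * \<eta>))) has_vector_derivative (z0 * \<eta> * w')) (at 0)"
    proof (rule field_vector_diff_chain_at[where g = w, unfolded o_def])
      show "((\<lambda>s::real. z0 * (1 + of_real s * \<eta>)) has_vector_derivative z0 * \<eta>) (at 0)"
        by (auto intro!: derivative_eq_intros)
      show "(w has_field_derivative w') (at (z0 * (1 + of_real 0 * \<eta>)))"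
        using D by simp
    qed
    then have "((\<lambda>s::real. w (z0 * (1 + of_real s * \<eta>)) / w z0) has_vector_derivative
        (z0 * \<eta> * w') / w z0) (at 0)"
      by (rule has_vector_derivative_divide)
    then have "(q has_real_derivative Re (z0 * \<eta> * w' / w z0)) (at 0)"
      unfolding q_def has_real_derivative_iff_has_vector_derivative
      by (rule bounded_linear.has_vector_derivative[OF bounded_linear_Re])
    then have "(v has_real_derivative (Re \<eta> - Re (\<eta> * A))) (at 0)"
      unfolding v_def by (auto intro!: derivative_eq_intros simp: A_def mult_ac)
    then obtain d where d: "d > 0" "\<And>s. 0 < s \<Longrightarrow> s < d \<Longrightarrow> v (0 + s) < v 0"
      using DERIV_neg_dec_right[OF _ neg] by blast
    have "v 0 = 0" using \<open>w z0 \<noteq> 0\<close> by (simp add: v_def q_def)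
    have "\<eta> \<noteq> 0" using \<eta> by auto
    \<comment> \<open>The first bound stays within the local decrease of \<open>v\<close>; the
      second gives \<open>s * |\<eta>|^2 \<le> - Re \<eta>\<close>, which keeps
      \<open>1 + s \<eta>\<close> inside the unit disc.\<close>
    define s where "s = min (d / 2) (- Re \<eta> / (norm \<eta>)\<^sup>2)"
    have s: "0 < s" "s < d"
      using d(1) \<eta> \<open>\<eta> \<noteq> 0\<close> by (auto simp: s_def divide_neg_pos)
    have sq: "(norm (1 + of_real s * \<eta>))\<^sup>2 = 1 + 2 * s * Re \<eta> + s\<^sup>2 * (norm \<eta>)\<^sup>2"
      by (simp add: cmod_power2) (simp add: algebra_simps power2_eq_square)
    have "s \<le> - Re \<eta> / (norm \<eta>)\<^sup>2" by (simp add: s_def)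
    then have "s * (norm \<eta>)\<^sup>2 \<le> - Re \<eta>"
      using \<open>\<eta> \<noteq> 0\<close> by (subst (asm) pos_le_divide_eq) auto
    then have "s * (s * (norm \<eta>)\<^sup>2) \<le> s * (- Re \<eta>)"
      using s(1) by (intro mult_left_mono) auto
    moreover have "s * Re \<eta> < 0" using s(1) \<eta> by (simp add: mult_pos_neg)
    ultimately have "(norm (1 + of_real s * \<eta>))\<^sup>2 < 1"
      unfolding sq by (simp add: power2_eq_square algebra_simps)
    then have lt: "norm (1 + of_real s * \<eta>) < 1"
      by (simp add: power2_less_1_iff)
    have "norm (w (z0 * (1 + of_real s * \<eta>))) \<le> \<rho> * norm (z0 * (1 + of_real s * \<eta>)) / R"
      by (rule Schwarz_ball[OF w]) (use lt z0 in \<open>auto simp: norm_mult\<close>)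
    then have "norm (w (z0 * (1 + of_real s * \<eta>)) / w z0) \<le> norm (1 + of_real s * \<eta>)"
      using z0 w0 by (simp add: norm_divide norm_mult pos_divide_le_eq mult.commute)
    then have "Re (w (z0 * (1 + of_real s * \<eta>)) / w z0) \<le> norm (1 + of_real s * \<eta>)"
      using complex_Re_le_cmod order_trans by blast
    also have "\<dots> \<le> (1 + (norm (1 + of_real s * \<eta>))\<^sup>2) / 2"
      using sum_squares_bound[of 1 "norm (1 + of_real s * \<eta>)"] by simp
    finally have "0 \<le> v s"
      unfolding sq v_def q_def by (simp add: field_simps)
    with d(2)[OF s] \<open>v 0 = 0\<close> show False by simp
  qed
  have "Im A = 0"
  proof (rule ccontr)
    assume "Im A \<noteq> 0"
    \<comment> \<open>This direction has real part \<open>-1\<close> and makes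
      \<open>Re (\<eta> * A)\<close> vanish, so \<open>key\<close> would give
      \<open>0 \<le> -1\<close>.\<close>
    with key[of "Complex (-1) (- Re A / Im A)"] show False by simp
  qed
  moreover have "1 \<le> Re A" using key[of "-1"] by simp
  moreover have "z0 * w' = A * w z0" using \<open>w z0 \<noteq> 0\<close> by (simp add: A_def)
  ultimately show ?thesis
    using that[of "Re A"] by (simp add: complex_eq_iff)
qed

theorem Suffridge_image_subset:
  fixes h G \<phi> :: "complex \<Rightarrow> complex"
  assumes \<phi>: "\<phi> holomorphic_on unit_disc" "inj_on \<phi> unit_disc" "convex (\<phi> ` unit_disc)" "\<phi> 0 = 0"
    and h: "h holomorphic_on unit_disc" "inj_on h unit_disc"
      "\<And>z. z \<in> unit_disc \<Longrightarrow> z * deriv h z = \<phi> z"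
    and G: "G holomorphic_on unit_disc" "G 0 = h 0"
      "\<And>z. z \<in> unit_disc \<Longrightarrow> z * deriv G z \<in> \<phi> ` unit_disc"
  shows "G ` unit_disc \<subseteq> h ` unit_disc"
proof (rule ccontr)
  assume "\<not> ?thesis"
  then obtain a where a: "a \<in> unit_disc" "G a \<notin> h ` unit_disc" by blast
  \<comment> \<open>Shrinking to radius \<open>\<rho>\<close> keeps the extremal point \<open>\<zeta>\<close> inside the disc, where \<open>h\<close> has an inverse.\<close>
  obtain \<rho> where \<rho>: "norm a < \<rho>" "\<rho> < 1" using a(1) dense by auto
  have "0 < \<rho>" using \<rho>(1) norm_ge_zero le_less_trans by blast
  have sub: "ball 0 \<rho> \<subseteq> unit_disc" "cball 0 \<rho> \<subseteq> unit_disc" "cball 0 (norm a) \<subseteq> unit_disc"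
    using \<rho> by auto
  note contG = holomorphic_on_imp_continuous_on[OF G(1)]
  note conth = holomorphic_on_imp_continuous_on[OF h(1)]
  have op: "open (h ` ball 0 \<rho>)" "open (h ` unit_disc)"
    using open_mapping_thm3[OF holomorphic_on_subset[OF h(1) sub(1)] open_ball inj_on_subset[OF h(2) sub(1)]]
      open_mapping_thm3[OF h(1) open_ball h(2)] by auto
  \<comment> \<open>A point of least modulus in \<open>C\<close> is a first exit of \<open>G\<close>
    from the image of the disc of radius \<rho>.\<close>
  define C where "C = cball 0 (norm a) \<inter> G -` (- (h ` ball 0 \<rho>))"
  have "closed C"
    unfolding C_def using op(1)
    by (intro continuous_closed_preimage continuous_on_subset[OF contG sub(3)]) auto
  moreover have "a \<in> C"
    using a(2) sub(1) by (auto simp: C_def)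
  ultimately obtain z0 where "z0 \<in> C" and min: "\<And>z. z \<in> C \<Longrightarrow> norm z0 \<le> norm z"
    using distance_attains_inf[of C 0] by auto
  define R where "R = norm z0"
  have z0: "norm z0 \<le> norm a" "G z0 \<notin> h ` ball 0 \<rho>"
    using \<open>z0 \<in> C\<close> by (auto simp: C_def)
  have z0D: "z0 \<in> unit_disc" using z0 a by auto
  have "0 < R"
    using z0(2) G(2) \<open>0 < \<rho>\<close> by (auto simp: R_def)
  have inR: "G z \<in> h ` ball 0 \<rho>" if "norm z < R" for z
    using min[of z] that z0(1) by (auto simp: C_def R_def)
  \<comment> \<open>Continuity puts \<open>G z0\<close> in the image of the closed disc; as it is
    not in that of the open disc, its preimage \<zeta> has modulus exactly \<rho>.\<close>
  have "closed (h ` cball 0 \<rho>)"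
    by (intro compact_imp_closed compact_continuous_image continuous_on_subset[OF conth sub(2)]) auto
  moreover have "continuous_on (closure (ball 0 R)) G"
    by (rule continuous_on_subset[OF contG]) (use z0(1) a(1) \<open>0 < R\<close> in \<open>auto simp: R_def\<close>)
  moreover have "G ` ball 0 R \<subseteq> h ` cball 0 \<rho>"
    using inR ball_subset_cball by fastforce
  ultimately have "G ` closure (ball 0 R) \<subseteq> h ` cball 0 \<rho>"
    using image_closure_subset by metis
  then have "G z0 \<in> h ` cball 0 \<rho>"
    using \<open>0 < R\<close> by (auto simp: R_def)
  then obtain \<zeta> where \<zeta>: "norm \<zeta> \<le> \<rho>" "G z0 = h \<zeta>" by auto
  with z0(2) have \<zeta>\<rho>: "norm \<zeta> = \<rho>" by force
  have \<zeta>D: "\<zeta> \<in> unit_disc" using \<zeta> \<rho> by auto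

  obtain k where k: "k holomorphic_on (h ` unit_disc)"
    and kh: "\<And>z. z \<in> unit_disc \<Longrightarrow> deriv h z * deriv k (h z) = 1 \<and> k (h z) = z"
    using holomorphic_has_inverse[OF h(1) open_ball h(2)] by metis
  define w where "w = k \<circ> G"
  have wz0: "w z0 = \<zeta>" using kh \<zeta> \<zeta>D by (simp add: w_def)
  obtain m :: real where m: "m \<ge> 1" "z0 * (deriv k (G z0) * deriv G z0) = of_real m * w z0"
  proof (rule Jack_lemma)
    show "w holomorphic_on ball 0 R"
      unfolding w_def
    proof (rule holomorphic_on_compose_gen[OF _ k])
      show "G holomorphic_on ball 0 R"
        using G(1) by (rule holomorphic_on_subset) (use z0 a in \<open>auto simp: R_def\<close>)
      show "G ` ball 0 R \<subseteq> h ` unit_disc"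
        using inR sub(1) by fastforce
    qed
    show "w 0 = 0" using kh[of 0] by (simp add: w_def G(2))
    show "norm (w z) < \<rho>" if "norm z < R" for z
    proof -
      obtain x where "x \<in> ball 0 \<rho>" "G z = h x" using inR[OF \<open>norm z < R\<close>] by blast
      then show ?thesis using kh[of x] sub(1) by (auto simp: w_def)
    qed
    show "norm (w z0) = \<rho>" using wz0 \<zeta>\<rho> by simp
    have "(k has_field_derivative deriv k (G z0)) (at (G z0))"
      using k op(2) \<zeta> \<zeta>D by (intro holomorphic_derivI[of k "h ` unit_disc"]) auto
    moreover have "(G has_field_derivative deriv G z0) (at z0)"
      using G(1) z0D by (intro holomorphic_derivI[of G unit_disc]) auto
    ultimately show "(w has_field_derivative deriv k (G z0) * deriv G z0) (at z0)"
      unfolding w_def by (rule DERIV_chain)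
  qed (use \<open>0 < \<rho>\<close> \<open>0 < R\<close> in \<open>auto simp: R_def\<close>)
  have "z0 * deriv G z0 = (z0 * (deriv k (G z0) * deriv G z0)) * deriv h \<zeta>"
    using kh[OF \<zeta>D] \<zeta> by (simp add: mult_ac)
  also have "\<dots> = of_real m * \<phi> \<zeta>"
    unfolding m(2) wz0 using h(3)[OF \<zeta>D] by (simp add: mult_ac)
  finally have eq: "z0 * deriv G z0 = of_real m * \<phi> \<zeta>" .

  \<comment> \<open>Two uses of Schwarz's lemma give
    \<open>|\<xi>| \<le> |\<eta>| \<le> |z0| < |\<zeta>|\<close>, although \<phi> takes the same
    value at \<xi> and \<zeta>.\<close>
  have "subordinate (\<lambda>z. z * deriv G z) \<phi>"
    using G \<phi> by (intro subordinate_univalentI) (auto intro!: holomorphic_intros)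
  then obtain \<eta> where \<eta>: "norm \<eta> \<le> norm z0" "z0 * deriv G z0 = \<phi> \<eta>"
    using subordinate_norm_le[OF _ z0D] by blast
  \<comment> \<open>Division by \<open>m \<ge> 1\<close> stays in the image of \<phi>, which is
    convex and contains \<open>0\<close>.\<close>
  have "subordinate (\<lambda>z. \<phi> z / of_real m) \<phi>"
  proof (rule subordinate_univalentI[OF \<phi>(1,2)])
    show "(\<lambda>z. \<phi> z / of_real m) ` unit_disc \<subseteq> \<phi> ` unit_disc"
    proof safe
      fix z :: complex assume "z \<in> unit_disc"
      then have "(1 - 1 / m) *\<^sub>R \<phi> 0 + (1 / m) *\<^sub>R \<phi> z \<in> \<phi> ` unit_disc"
        using m(1) by (intro convexD[OF \<phi>(3)]) auto
      then show "\<phi> z / of_real m \<in> \<phi> ` unit_disc"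
        by (simp add: \<phi>(4) scaleR_conv_of_real)
    qed
  qed (use m(1) \<phi> in \<open>auto intro!: holomorphic_intros\<close>)
  then obtain \<xi> where \<xi>: "norm \<xi> \<le> norm \<eta>" "\<phi> \<eta> / of_real m = \<phi> \<xi>"
    using subordinate_norm_le[of _ \<phi> \<eta>] \<eta> z0D by auto
  have "\<phi> \<zeta> = \<phi> \<xi>"
    using eq \<eta> \<xi> m(1) by (auto simp: field_simps)
  moreover have "norm \<xi> < norm \<zeta>"
    using \<xi> \<eta> z0 \<rho> \<zeta>\<rho> by linarith
  ultimately show False
    using inj_onD[OF \<phi>(2), of \<zeta> \<xi>] \<zeta>D by auto
qed

text \<open>With \<open>c = x / y\<close>, the function \<open>G\<close> in the proof takes at
  \<open>y\<close> the desired combination of \<open>h x\<close> and \<open>h y\<close>. Ordering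
  the points by modulus ensures \<open>|c| \<le> 1\<close>, so that \<open>c * z\<close> stays in
  the disc.\<close>

lemma convex_image_of_convex_derivative:
  fixes h \<phi> :: "complex \<Rightarrow> complex"
  assumes \<phi>: "\<phi> holomorphic_on unit_disc" "inj_on \<phi> unit_disc" "convex (\<phi> ` unit_disc)" "\<phi> 0 = 0"
    and h: "h holomorphic_on unit_disc" "inj_on h unit_disc"
      "\<And>z. z \<in> unit_disc \<Longrightarrow> z * deriv h z = \<phi> z"
  shows "convex (h ` unit_disc)"
proof -
  have *: "u *\<^sub>R h x + v *\<^sub>R h y \<in> h ` unit_disc"
    if uv: "u \<ge> 0" "v \<ge> 0" "u + v = 1" and xy: "norm x \<le> norm y" "y \<in> unit_disc" for u v x y
  proof (cases "y = 0")
    case True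
    then have "u *\<^sub>R h x + v *\<^sub>R h y = h 0"
      using xy uv(3) by (simp flip: scaleR_left_distrib)
    then show ?thesis by auto
  next
    case False
    define c where "c = x / y"
    have "norm c \<le> 1" "c * y = x"
      using xy False by (auto simp: c_def norm_divide divide_simps)
    have cz: "c * z \<in> unit_disc" if "z \<in> unit_disc" for z
      using mult_mono[OF \<open>norm c \<le> 1\<close> order_refl[of "norm z"]] that by (auto simp: norm_mult)
    \<comment> \<open>\<open>z G'\<close> is the same convex combination of values of \<open>\<phi>\<close>.\<close>
    define G where "G = (\<lambda>z. u *\<^sub>R h (c * z) + v *\<^sub>R h z)"
    have hol: "(\<lambda>z. h (c * z)) holomorphic_on unit_disc"
      using holomorphic_on_compose_gen[OF _ h(1), of "\<lambda>z. c * z" unit_disc] cz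
      by (auto simp: o_def image_subset_iff intro!: holomorphic_intros)
    have "G ` unit_disc \<subseteq> h ` unit_disc"
    proof (rule Suffridge_image_subset[OF \<phi> h])
      show "G holomorphic_on unit_disc"
        unfolding G_def scaleR_conv_of_real by (intro holomorphic_intros hol h)
      show "G 0 = h 0"
        using uv(3) by (simp add: G_def flip: scaleR_left_distrib)
      show "z * deriv G z \<in> \<phi> ` unit_disc" if z: "z \<in> unit_disc" for z
      proof -
        have dh: "(h has_field_derivative deriv h w) (at w)" if "w \<in> unit_disc" for w
          using holomorphic_derivI[OF h(1) open_ball that] .
        have "((\<lambda>z. h (c * z)) has_field_derivative deriv h (c * z) * c) (at z)"
          by (rule DERIV_chain2[where f = h and g = "\<lambda>z. c * z", OF dh[OF cz[OF z]]]) (auto intro!: derivative_eq_intros)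
        then have "(G has_field_derivative (u *\<^sub>R (deriv h (c * z) * c) + v *\<^sub>R deriv h z)) (at z)"
          unfolding G_def scaleR_conv_of_real
          by (auto intro!: derivative_eq_intros dh[OF z])
        then have "z * deriv G z = u *\<^sub>R \<phi> (c * z) + v *\<^sub>R \<phi> z"
          by (simp add: DERIV_imp_deriv scaleR_conv_of_real algebra_simps
              flip: h(3)[OF z] h(3)[OF cz[OF z]])
        then show ?thesis
          using convexD[OF \<phi>(3)] uv z cz[OF z] by auto
      qed
    qed
    then show ?thesis
      using xy \<open>c * y = x\<close> by (auto simp: G_def)
  qed
  show ?thesis
  proof (rule convexI)
    fix p q and u v :: real
    assume "p \<in> h ` unit_disc" "q \<in> h ` unit_disc" and uv: "0 \<le> u" "0 \<le> v" "u + v = 1"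
    then obtain x y where xy: "p = h x" "q = h y" "x \<in> unit_disc" "y \<in> unit_disc" by blast
    show "u *\<^sub>R p + v *\<^sub>R q \<in> h ` unit_disc"
      using *[of u v x y] *[of v u y x] uv xy by (cases "norm x \<le> norm y") (auto simp: add.commute)
  qed
qed

section \<open>A univalence criterion and segment integrals\<close>

text \<open>After division by \<open>y - x\<close>, the mean value theorem along the segment turns
  \<open>h x = h y\<close> into \<open>Re (c * h' u) = 0\<close> for some \<open>u\<close> on
  it.\<close>

lemma Noshiro_Warschawski:
  fixes h :: "complex \<Rightarrow> complex"
  assumes "convex S" "\<And>z. z \<in> S \<Longrightarrow> (h has_field_derivative h' z) (at z)"
    and pos: "\<And>z. z \<in> S \<Longrightarrow> Re (c * h' z) > 0"
  shows "inj_on h S"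
proof (rule inj_onI, rule ccontr)
  fix x y assume xy: "x \<in> S" "y \<in> S" "h x = h y" "x \<noteq> y"
  have seg: "closed_segment x y \<subseteq> S"
    using xy assms(1) by (simp add: closed_segment_subset)
  have "((\<lambda>z. c / (y - x) * h z) has_field_derivative c / (y - x) * h' u) (at u)"
    if "u \<in> closed_segment x y" for u
    using assms(2)[of u] seg that xy(4) by (auto intro!: derivative_eq_intros)
  then obtain u where "u \<in> closed_segment x y"
      "Re (c / (y - x) * h y) - Re (c / (y - x) * h x) = Re (c / (y - x) * h' u * (y - x))"
    using complex_mvt_line[of x y "\<lambda>z. c / (y - x) * h z" "\<lambda>u. c / (y - x) * h' u"] by blast
  then show False
    using pos[of u] seg xy(3,4) by auto
qed

text \<open>The exceptional set \<open>K\<close> absorbs points where the integrand has an arbitrary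
  value, such as the removable singularity in \<open>P_hat\<close>.\<close>

lemma contour_integral_linepath_primitive:
  assumes "finite K" "\<And>t. t \<in> closed_segment a b \<Longrightarrow> (H has_field_derivative \<psi> t) (at t)"
    and "\<And>t. t \<in> closed_segment a b - K \<Longrightarrow> g t = \<psi> t"
  shows "contour_integral (linepath a b) g = H b - H a"
proof (cases "a = b")
  case False
  have "(\<psi> has_contour_integral (H b - H a)) (linepath a b)"
    using contour_integral_primitive[of "closed_segment a b" H \<psi> "linepath a b"] assms(2)
    by (auto intro: has_field_derivative_at_within)
  then have *: "((\<lambda>x. \<psi> (linepath a b x) * (b - a)) has_integral (H b - H a)) {0..1}"
    by (simp add: has_contour_integral_linepath)
  have "finite (linepath a b -` K \<inter> {0..1})"
    using False assms(1) by (intro finite_vimage_IntI) (auto simp: inj_on_linepath)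
  then have "((\<lambda>x. g (linepath a b x) * (b - a)) has_integral (H b - H a)) {0..1}"
    by (rule has_integral_spike_finite[OF _ _ *])
       (use assms(3) in \<open>auto simp: linepath_in_path\<close>)
  then show ?thesis
    by (simp add: has_contour_integral_linepath contour_integral_unique)
qed auto

section \<open>The strip map as the logarithm of a Moebius map\<close>

text \<open>
  With \<open>a = \<pi> (1 - \<alpha>) / (\<beta> - \<alpha>)\<close> this is the logarithm in \<open>P_strip \<alpha> \<beta>\<close>; both arguments of \<open>Ln\<close> lie in
  the right half-plane, so principal branches are the correct ones.
\<close>

definition strip_log :: "real \<Rightarrow> complex \<Rightarrow> complex"
  where "strip_log a z = Ln (1 - cis (2 * a) * z) - Ln (1 - z)"

lemma one_minus_nonpos:
  fixes u z :: complex
  assumes "norm z < 1" "norm u \<le> 1"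
  shows "1 - u * z \<notin> \<real>\<^sub>\<le>\<^sub>0"
proof -
  have "norm (u * z) < 1"
    using assms mult_mono[of "norm u" 1 "norm z" "norm z"] by (simp add: norm_mult)
  then have "Re (u * z) < 1"
    using complex_Re_le_cmod le_less_trans by blast
  then show ?thesis by (auto simp: complex_nonpos_Reals_iff)
qed

lemma strip_log_holomorphic: "strip_log a holomorphic_on unit_disc"
  unfolding strip_log_def
  using one_minus_nonpos[of _ "cis (2 * a)"] one_minus_nonpos[of _ 1]
  by (intro holomorphic_intros) auto

lemma exp_strip_log:
  assumes "z \<in> unit_disc"
  shows "exp (strip_log a z) = (1 - cis (2 * a) * z) / (1 - z)"
proof -
  have "1 - cis (2 * a) * z \<noteq> 0" "1 - z \<noteq> 0"
    using one_minus_nonpos[of z "cis (2 * a)"] one_minus_nonpos[of z 1] assms by auto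
  then show ?thesis by (simp add: strip_log_def exp_diff)
qed

text \<open>Multiplying the numerator by the conjugate of the denominator preserves the sign of the
  imaginary part.\<close>

lemma Im_half_plane_map_neg:
  assumes "0 < a" "a < pi" "norm z < 1"
  shows "Im ((cis (- a) - cis a * z) / (1 - z)) < 0"
proof -
  have "Im ((cis (- a) - cis a * z) * cnj (1 - z)) = - sin a * (1 - (norm z)\<^sup>2)"
    by (simp add: cmod_power2) (simp add: algebra_simps power2_eq_square)
  also have "\<dots> < 0"
    using assms sin_gt_zero[of a] by (simp add: power_less_one_iff)
  finally show ?thesis
    using Im_complex_div_lt_0 by blast
qed

text \<open>Both sides are logarithms of the same function and vanish at \<open>0\<close>. The
  factor \<open>cis (- a)\<close> moves the Moebius image into the lower half-plane, off the cut, so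
  a single \<open>Ln\<close> suffices and shows the range.\<close>

lemma strip_log_eq:
  assumes a: "0 < a" "a < pi" and z: "z \<in> unit_disc"
  shows "strip_log a z = Ln ((cis (- a) - cis a * z) / (1 - z)) + \<i> * of_real a"
proof (rule disc_log_unique[OF strip_log_holomorphic _ exp_strip_log _ _ _ z])
  let ?Q = "\<lambda>z. (cis (- a) - cis a * z) / (1 - z)"
  have Q: "Im (?Q w) < 0" if "w \<in> unit_disc" for w
    using Im_half_plane_map_neg[OF a] that by simp
  then have Q': "?Q w \<notin> \<real>\<^sub>\<le>\<^sub>0" "?Q w \<noteq> 0" if "w \<in> unit_disc" for w
    using that by (force simp: complex_nonpos_Reals_iff)+
  show "(\<lambda>z. Ln (?Q z) + \<i> * of_real a) holomorphic_on unit_disc"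
    using Q'(1) by (intro holomorphic_intros) auto
  show "strip_log a 0 = 0" by (simp add: strip_log_def)
  show "Ln (?Q 0) + \<i> * of_real a = 0"
    using a by (simp add: cis_conv_exp Ln_exp)
  show "exp (Ln (?Q w) + \<i> * of_real a) = (1 - cis (2 * a) * w) / (1 - w)" if "w \<in> unit_disc" for w
  proof -
    have "exp (Ln (?Q w) + \<i> * of_real a) = ?Q w * cis a"
      using Q'(2)[OF that] by (simp add: exp_add cis_conv_exp)
    also have "\<dots> = (cis (-a) * cis a - cis a * cis a * w) / (1 - w)"
      by (simp add: algebra_simps)
    finally show ?thesis by (simp add: cis_mult)
  qed
qed auto

text \<open>Exponentiating leaves a Moebius map, nondegenerate because \<open>cis (2 * a)\<close>
  differs from \<open>1\<close>.\<close>

lemma strip_log_inj: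
  assumes "0 < a" "a < pi"
  shows "inj_on (strip_log a) unit_disc"
proof (rule inj_onI)
  fix x y assume xy: "x \<in> unit_disc" "y \<in> unit_disc" "strip_log a x = strip_log a y"
  have "(1 - cis (2 * a) * x) / (1 - x) = (1 - cis (2 * a) * y) / (1 - y)"
    using exp_strip_log xy by metis
  moreover have "1 - x \<noteq> 0" "1 - y \<noteq> 0" using xy by auto
  ultimately have "(1 - cis (2 * a) * x) * (1 - y) = (1 - cis (2 * a) * y) * (1 - x)"
    by (metis frac_eq_eq)
  then have "(1 - cis (2 * a)) * (x - y) = 0"
    by algebra
  moreover have "cis (2 * a) \<noteq> 1"
  proof
    assume "cis (2 * a) = 1"
    then have "cos (2 * a) = 1" by (metis cis.sel(1) one_complex.sel(1))
    then show False
      using assms sin_gt_zero[of a] by (simp add: cos_double_sin)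
  qed
  ultimately show "x = y" by simp
qed

lemma strip_log_image:
  assumes a: "0 < a" "a < pi"
  shows "strip_log a ` unit_disc = {v. a - pi < Im v \<and> Im v < a}"
proof (intro equalityI subsetI)
  fix v assume "v \<in> strip_log a ` unit_disc"
  then obtain z where z: "z \<in> unit_disc" "v = strip_log a z" by blast
  let ?Q = "(cis (- a) - cis a * z) / (1 - z)"
  have Q: "Im ?Q < 0" using Im_half_plane_map_neg[OF a] z by simp
  then have "?Q \<noteq> 0" by auto
  then have "Im (Ln ?Q) < 0" "Im (Ln ?Q) > - pi"
    using Im_Ln_pos_le[of ?Q] Im_Ln_le_pi[of ?Q] mpi_less_Im_Ln[of ?Q] Q by linarith+
  then show "v \<in> {v. a - pi < Im v \<and> Im v < a}"
    using z strip_log_eq[OF a z(1)] by simp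
next
  fix v assume v: "v \<in> {v. a - pi < Im v \<and> Im v < a}"
  define y where "y = exp (v - \<i> * of_real a)"
  have "sin (a - Im v) > 0" using v by (intro sin_gt_zero) auto
  then have "Im y < 0"
    using sin_minus[of "a - Im v"] by (simp add: y_def Im_exp mult_less_0_iff)
  have "sin a > 0" using a by (intro sin_gt_zero)
  \<comment> \<open>This solves \<open>(cis (- a) - cis a * z) / (1 - z) = y\<close>. It lies in the
    disc because \<open>y\<close>, in the lower half-plane, is nearer to \<open>cis (- a)\<close>
    than to \<open>cis a\<close>.\<close>
  define z where "z = (y - cis (- a)) / (y - cis a)"
  have "y \<noteq> cis a" using \<open>Im y < 0\<close> \<open>sin a > 0\<close> by auto
  have "(norm (y - cis (- a)))\<^sup>2 - (norm (y - cis a))\<^sup>2 = 4 * (Im y * sin a)"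
    by (simp add: cmod_power2) (simp add: algebra_simps power2_eq_square)
  also have "\<dots> < 0" using \<open>Im y < 0\<close> \<open>sin a > 0\<close> by (simp add: mult_neg_pos)
  finally have "norm (y - cis (- a)) < norm (y - cis a)"
    by (simp add: power_less_imp_less_base)
  then have z: "z \<in> unit_disc" using \<open>y \<noteq> cis a\<close> by (simp add: z_def norm_divide)
  have "cis (- a) \<noteq> cis a" using \<open>sin a > 0\<close> by (auto simp: complex_eq_iff)
  have "1 - z = (cis (- a) - cis a) / (y - cis a)"
    using \<open>y \<noteq> cis a\<close> by (simp add: z_def field_simps)
  moreover have "cis (- a) - cis a * z = y * (cis (- a) - cis a) / (y - cis a)"
    using \<open>y \<noteq> cis a\<close> by (simp add: z_def field_simps)
  ultimately have "(cis (- a) - cis a * z) / (1 - z) = y"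
    using \<open>y \<noteq> cis a\<close> \<open>cis (- a) \<noteq> cis a\<close> by simp
  then have "strip_log a z = v"
    using strip_log_eq[OF a z] v a by (simp add: y_def Ln_exp)
  with z show "v \<in> strip_log a ` unit_disc" by blast
qed

section \<open>Positivity of the rotated quotient \<open>strip_log a z / z\<close>\<close>

text \<open>For \<open>p = cis t\<close> and \<open>p = cis (- t)\<close> the first factor is the
  same, \<open>cos t - Re w\<close>, and can be pulled out of the sum.\<close>

lemma Re_inverse_diff:
  "Re (1 / (p - w)) = (Re p - Re w) * (1 / (norm (p - w))\<^sup>2)" for p w :: complex
  by (simp add: Re_divide' cmod_power2)

lemma Re_log_quotient_pos:
  assumes a: "0 < a" "a < pi" and w: "norm w < 1" "w \<noteq> 0"
  shows "Re (\<i> * (Ln (1 - cis a * w) - Ln (1 - cis (- a) * w)) / w) > 0"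
proof -
  \<comment> \<open>A complex parameter lets the complex rules for \<open>Ln\<close> and
    \<open>exp\<close> apply; \<open>F\<close> is the real part on the real axis, and
    \<open>c\<close> is the positive factor of its derivative.\<close>
  define \<Phi> where "\<Phi> = (\<lambda>s. \<i> * (Ln (1 - exp (\<i> * s) * w) - Ln (1 - exp (- (\<i> * s)) * w)) / w)"
  define F where "F = (\<lambda>t::real. Re (\<Phi> (of_real t)))"
  define c where "c = (\<lambda>t. 1 / (norm (cis (- t) - w))\<^sup>2 + 1 / (norm (cis t - w))\<^sup>2)"
  have F: "F t = Re (\<i> * (Ln (1 - cis t * w) - Ln (1 - cis (- t) * w)) / w)" for t
    by (simp add: F_def \<Phi>_def cis_conv_exp)
  have ne: "cis t \<noteq> w" for t
    using w(1) by auto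
  have cpos: "c t > 0" for t
    using ne[of t] ne[of "- t"] by (auto simp: c_def intro!: add_pos_pos)
  have D: "(F has_real_derivative (cos t - Re w) * c t) (at t)" for t
  proof -
    let ?e = "exp (\<i> * of_real t)" and ?e' = "exp (- (\<i> * of_real t))"
    have np: "1 - ?e * w \<notin> \<real>\<^sub>\<le>\<^sub>0" "1 - ?e' * w \<notin> \<real>\<^sub>\<le>\<^sub>0"
      using w(1) one_minus_nonpos[of w ?e] one_minus_nonpos[of w ?e'] by simp_all
    then have nz: "1 - ?e * w \<noteq> 0" "1 - ?e' * w \<noteq> 0" by auto
    have ee: "?e * ?e' = 1" by (simp flip: exp_add)
    have ne': "?e - w \<noteq> 0" "?e' - w \<noteq> 0"
      using ne[of t] ne[of "- t"] by (auto simp: cis_conv_exp)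
    have L: "((\<lambda>s. Ln (1 - exp (c * s) * w)) has_field_derivative
        - (exp (c * of_real t) * c * w) / (1 - exp (c * of_real t) * w)) (at (of_real t))"
      if "1 - exp (c * of_real t) * w \<notin> \<real>\<^sub>\<le>\<^sub>0" for c
      using that by (auto intro!: derivative_eq_intros simp: divide_inverse mult_ac)
    have "(\<Phi> has_field_derivative
        (\<i> * (- (?e * \<i> * w) / (1 - ?e * w) - ?e' * \<i> * w / (1 - ?e' * w)) / w)) (at (of_real t))"
      unfolding \<Phi>_def
      using DERIV_cdivide[OF DERIV_cmult[OF DERIV_diff[OF L[of "\<i>"] L[of "- \<i>"]]], of "\<i>" w] np
      by simp
    also have "\<i> * (- (?e * \<i> * w) / (1 - ?e * w) - ?e' * \<i> * w / (1 - ?e' * w)) / w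
        = ?e / (1 - ?e * w) + ?e' / (1 - ?e' * w)"
    proof -
      have "\<i> * (- (x * \<i> * w) / p - y * \<i> * w / q) = (x / p + y / q) * w" for x y p q :: complex
        by (simp add: algebra_simps)
      then show ?thesis using w(2) by simp
    qed
    also have "?e / (1 - ?e * w) = 1 / (?e' - w)"
      using nz ne' ee by (simp add: divide_simps) (simp add: algebra_simps)
    also have "?e' / (1 - ?e' * w) = 1 / (?e - w)"
      using nz ne' ee by (simp add: divide_simps) (simp add: algebra_simps)
    also have "1 / (?e' - w) + 1 / (?e - w) = 1 / (cis (- t) - w) + 1 / (cis t - w)"
      by (simp add: cis_conv_exp)
    finally have "((\<lambda>x. \<Phi> (of_real x)) has_vector_derivative
        (1 / (cis (- t) - w) + 1 / (cis t - w))) (at t)"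
      by (rule has_vector_derivative_real_field)
    then have "(F has_real_derivative Re (1 / (cis (- t) - w) + 1 / (cis t - w))) (at t)"
      unfolding F_def has_real_derivative_iff_has_vector_derivative
      by (rule bounded_linear.has_vector_derivative[OF bounded_linear_Re])
    then show ?thesis
      unfolding plus_complex.sel Re_inverse_diff by (simp add: c_def algebra_simps)
  qed
  have cont: "continuous_on A F" for A
    using D by (meson DERIV_isCont continuous_at_imp_continuous_on)
  \<comment> \<open>\<open>F\<close> vanishes at \<open>0\<close> and \<open>\<pi>\<close> and, \<open>cos\<close> being decreasing, first increases and then decreases.\<close>
  have "F a > 0"
  proof (cases "cos a \<ge> Re w")
    case True
    have "F 0 < F a"
    proof (rule DERIV_pos_imp_increasing_open[OF a(1) _ cont])
      fix t assume t: "0 < t" "t < a"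
      then have "cos t > Re w" using True cos_monotone_0_pi[of t a] a by auto
      then show "\<exists>y. (F has_real_derivative y) (at t) \<and> y > 0"
        using D[of t] cpos[of t] by (intro exI[of _ "(cos t - Re w) * c t"]) auto
    qed
    then show ?thesis by (simp add: F)
  next
    case False
    have "F a > F pi"
    proof (rule DERIV_neg_imp_decreasing_open[OF a(2) _ cont])
      fix t assume t: "a < t" "t < pi"
      then have "cos t < Re w" using False cos_monotone_0_pi[of a t] a by auto
      then show "\<exists>y. (F has_real_derivative y) (at t) \<and> y < 0"
        using D[of t] cpos[of t] by (intro exI[of _ "(cos t - Re w) * c t"]) (auto simp: mult_neg_pos)
    qed
    moreover have "cis (- pi) = cis pi" by (simp add: complex_eq_iff)
    ultimately show ?thesis by (simp only: F) simp
  qed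
  then show ?thesis by (simp add: F)
qed

text \<open>Substitute \<open>w = cis a * z\<close>; dividing by \<open>w\<close> instead of
  \<open>z\<close> accounts for the factor \<open>cis (- a)\<close>.\<close>

lemma Re_strip_log_quotient_pos:
  assumes a: "0 < a" "a < pi" and z: "z \<in> unit_disc" "z \<noteq> 0"
  shows "Re (\<i> * cis (- a) * (strip_log a z / z)) > 0"
proof -
  have "strip_log a z = Ln (1 - cis a * (cis a * z)) - Ln (1 - cis (- a) * (cis a * z))"
    by (simp add: strip_log_def cis_mult flip: mult.assoc)
  moreover have "\<i> * cis (- a) * (x / z) = \<i> * x / (cis a * z)" for x
    by (simp add: divide_simps cis_mult flip: cis_inverse)
  ultimately show ?thesis
    using Re_log_quotient_pos[OF a, of "cis a * z"] z by (simp add: norm_mult)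
qed

lemma deriv_strip_log_0: "deriv (strip_log a) 0 = 1 - cis (2 * a)"
  by (rule DERIV_imp_deriv) (auto simp: strip_log_def [abs_def] intro!: derivative_eq_intros)

text \<open>Covers the value that fills the removable singularity of the quotient; the real part is
  \<open>2 * sin a\<close>.\<close>

lemma Re_deriv_strip_log_0_pos:
  assumes "0 < a" "a < pi"
  shows "Re (\<i> * cis (- a) * deriv (strip_log a) 0) > 0"
proof -
  have *: "\<i> * cis (- a) * (1 - cis (2 * a)) = \<i> * (cis (- a) - cis a)"
    by (simp add: right_diff_distrib cis_mult mult.assoc)
  then show ?thesis
    unfolding deriv_strip_log_0 * using sin_gt_zero[of a] assms by simp
qed

section \<open>Branches and primitives behind \<open>P_strip\<close>, \<open>log_f_over_z\<close>
  and \<open>P_hat\<close>\<close>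

lemma P_strip_eq:
  assumes "z \<in> unit_disc"
  shows "P_strip \<alpha> \<beta> z =
    1 + of_real ((\<beta> - \<alpha>) / pi) * \<i> * strip_log (pi * ((1 - \<alpha>) / (\<beta> - \<alpha>))) z"
proof -
  define a where "a = pi * ((1 - \<alpha>) / (\<beta> - \<alpha>))"
  define M where "M = (\<lambda>w. (1 - cis (2 * a) * w) / (1 - w))"
  have nz: "1 - cis (2 * a) * w \<noteq> 0" "1 - w \<noteq> 0" if "w \<in> unit_disc" for w
    using one_minus_nonpos[of w "cis (2 * a)"] one_minus_nonpos[of w 1] that by auto
  have "M holomorphic_on unit_disc"
    unfolding M_def using nz by (intro holomorphic_intros) auto
  moreover have "M z \<noteq> 0" if "z \<in> unit_disc" for z
    using nz[OF that] by (simp add: M_def)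
  moreover have "M 0 = 1"
    by (simp add: M_def)
  ultimately have M: "disc_log M holomorphic_on unit_disc" "disc_log M 0 = 0"
      "\<And>z. z \<in> unit_disc \<Longrightarrow> exp (disc_log M z) = M z"
    using disc_log by blast+
  have "exp (strip_log a z) = M z" if "z \<in> unit_disc" for z
    using exp_strip_log[OF that] by (simp add: M_def)
  then have "disc_log M z = strip_log a z"
    by (intro disc_log_unique[OF M strip_log_holomorphic _ _ assms]) (simp_all add: strip_log_def)
  moreover have "cis (2 * a) = exp (2 * of_real pi * \<i> * of_real ((1 - \<alpha>) / (\<beta> - \<alpha>)))"
    by (simp only: cis_conv_exp a_def of_real_mult of_real_numeral mult_ac)
  ultimately show ?thesis
    unfolding P_strip_def a_def M_def by simp
qed

text \<open>The derivative identity comes from differentiating \<open>f z = z * exp (g z)\<close>,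
  where \<open>g\<close> is the logarithm, and dividing by
  \<open>exp (g z) = f z / z\<close>.\<close>

lemma log_f_over_z:
  assumes "f \<in> class_S \<alpha> \<beta>"
  shows "log_f_over_z f holomorphic_on unit_disc" "log_f_over_z f 0 = 0"
    and "\<And>z. z \<in> unit_disc \<Longrightarrow> z * deriv (log_f_over_z f) z = zf'_over_f f z - 1"
proof -
  have f: "f holomorphic_on unit_disc" "f 0 = 0" "deriv f 0 = 1"
    and nz: "\<And>z. z \<in> unit_disc - {0} \<Longrightarrow> f z \<noteq> 0"
    using assms by (auto simp: class_S_def normalized_class_def)
  define h where "h = (\<lambda>z. if z = 0 then 1 else f z / z)"
  have "h holomorphic_on unit_disc"
    using pole_lemma_open[OF f(1) open_ball, of 0]
    by (rule holomorphic_transform) (simp add: h_def f)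
  moreover have "h z \<noteq> 0" if "z \<in> unit_disc" for z
    using nz that by (simp add: h_def)
  moreover have "h 0 = 1" by (simp add: h_def)
  ultimately have G: "disc_log h holomorphic_on unit_disc" "disc_log h 0 = 0"
    and exp: "\<And>z. z \<in> unit_disc \<Longrightarrow> exp (disc_log h z) = h z"
    using disc_log by blast+
  have eq: "log_f_over_z f = disc_log h"
    by (simp add: log_f_over_z_def h_def)
  show "log_f_over_z f holomorphic_on unit_disc" "log_f_over_z f 0 = 0"
    using G by (simp_all add: eq)
  show "z * deriv (log_f_over_z f) z = zf'_over_f f z - 1" if z: "z \<in> unit_disc" for z
  proof (cases "z = 0")
    case False
    have "(disc_log h has_field_derivative deriv (disc_log h) z) (at z)"
      using holomorphic_derivI[OF G(1) open_ball z] .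
    then have "((\<lambda>w. w * exp (disc_log h w)) has_field_derivative
        exp (disc_log h z) * (1 + z * deriv (disc_log h) z)) (at z)"
      by (auto intro!: derivative_eq_intros simp: algebra_simps)
    then have "(f has_field_derivative exp (disc_log h z) * (1 + z * deriv (disc_log h) z)) (at z)"
      by (rule has_field_derivative_transform_within_open[OF _ open_ball z])
         (simp add: exp, simp add: h_def f)
    then have "deriv f z = exp (disc_log h z) * (1 + z * deriv (disc_log h) z)"
      by (rule DERIV_imp_deriv)
    also have "exp (disc_log h z) = f z / z"
      using exp[OF z] False by (simp add: h_def)
    finally have "deriv f z = f z / z * (1 + z * deriv (disc_log h) z)" .
    then show ?thesis
      using False nz z by (simp add: zf'_over_f_def eq)
  qed (simp add: zf'_over_f_def)
qed

text \<open>On the convex disc the integrand with its singularity filled has a primitive, which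
  evaluates every segment integral.\<close>

lemma P_hat_primitive:
  obtains H where "\<And>z. z \<in> unit_disc \<Longrightarrow> P_hat \<alpha> \<beta> z = H z"
    and "\<And>z. z \<in> unit_disc \<Longrightarrow> (H has_field_derivative
      (of_real ((\<beta> - \<alpha>) / pi) * \<i> * (if z = 0 then deriv (strip_log (pi * ((1 - \<alpha>) / (\<beta> - \<alpha>)))) 0
         else strip_log (pi * ((1 - \<alpha>) / (\<beta> - \<alpha>))) z / z))) (at z)"
proof -
  define a where "a = pi * ((1 - \<alpha>) / (\<beta> - \<alpha>))"
  define \<psi> where "\<psi> = (\<lambda>z. of_real ((\<beta> - \<alpha>) / pi) * \<i> *
    (if z = 0 then deriv (strip_log a) 0 else strip_log a z / z))"
  have "(\<lambda>z. if z = 0 then deriv (strip_log a) 0 else strip_log a z / z) holomorphic_on unit_disc"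
    using pole_lemma_open[OF strip_log_holomorphic open_ball, of 0 a]
    by (rule holomorphic_transform) (simp add: strip_log_def)
  then have "\<psi> holomorphic_on unit_disc"
    unfolding \<psi>_def by (intro holomorphic_intros)
  then obtain H where "\<And>z. z \<in> unit_disc \<Longrightarrow> (H has_field_derivative \<psi> z) (at z within unit_disc)"
    using holomorphic_convex_primitive'[OF convex_ball open_ball] by metis
  then have H: "(H has_field_derivative \<psi> z) (at z)" if "z \<in> unit_disc" for z
    using that by (metis at_within_open open_ball)
  have "P_hat \<alpha> \<beta> z = H z - H 0" if z: "z \<in> unit_disc" for z
    unfolding P_hat_def
  \<comment> \<open>At \<open>t = 0\<close> the integrand is \<open>0\<close> by division by zero,
    whereas \<open>\<psi> 0\<close> is the limit.\<close>
  proof (rule contour_integral_linepath_primitive[where K = "{0}"])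
    have seg: "closed_segment 0 z \<subseteq> unit_disc"
      using z by (intro closed_segment_subset) auto
    show "(H has_field_derivative \<psi> t) (at t)" if "t \<in> closed_segment 0 z" for t
      using seg that H by blast
    show "(P_strip \<alpha> \<beta> t - 1) / t = \<psi> t" if "t \<in> closed_segment 0 z - {0}" for t
      using seg that P_strip_eq[of t \<alpha> \<beta>] by (auto simp: \<psi>_def a_def)
  qed auto
  moreover have "((\<lambda>z. H z - H 0) has_field_derivative \<psi> z) (at z)" if "z \<in> unit_disc" for z
    using H[OF that] by (auto intro!: derivative_eq_intros)
  ultimately show ?thesis
    using that[of "\<lambda>z. H z - H 0"] unfolding \<psi>_def a_def by blast
qed

section \<open>Application of Suffridge's theorem to the strip map\<close>

theorem theorem2p1:
  fixes \<alpha> \<beta> :: real and f :: "complex \<Rightarrow> complex"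
  assumes "\<alpha> < 1" and "\<beta> > 1"
    and "f \<in> normalized_class"
    and "f \<in> class_S \<alpha> \<beta>"
  shows "log_f_over_z f \<prec> P_hat \<alpha> \<beta> \<and> convex_univalent (P_hat \<alpha> \<beta>)"
proof -
  define a where "a = pi * ((1 - \<alpha>) / (\<beta> - \<alpha>))"
  define K where "K = (\<beta> - \<alpha>) / pi"
  define \<phi> where "\<phi> = (\<lambda>z. of_real K * \<i> * strip_log a z)"
  \<comment> \<open>Since \<open>Re (of_real K * \<i> * v) = - K * Im v\<close>, these identities
    carry the strip \<open>a - pi < Im v < a\<close> onto
    \<open>\<alpha> - 1 < Re v < \<beta> - 1\<close>.\<close>
  have "K > 0" and Ka: "K * a = 1 - \<alpha>" "K * (a - pi) = 1 - \<beta>"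
    using assms(1,2) by (auto simp: K_def a_def field_simps)
  have a: "0 < a" "a < pi"
    using assms(1,2) by (auto simp: a_def field_simps)

  have \<phi>: "\<phi> holomorphic_on unit_disc" "\<phi> 0 = 0"
    unfolding \<phi>_def by (auto intro!: holomorphic_intros strip_log_holomorphic) (simp add: strip_log_def)
  have \<phi>_inj: "inj_on \<phi> unit_disc"
    using strip_log_inj[OF a] \<open>K > 0\<close> by (auto simp: inj_on_def \<phi>_def)
  have \<phi>_image: "\<phi> ` unit_disc = {v. \<alpha> - 1 < Re v \<and> Re v < \<beta> - 1}"
  proof -
    have "\<phi> ` unit_disc = (\<lambda>v. of_real K * \<i> * v) ` {v. a - pi < Im v \<and> Im v < a}"
      by (simp add: \<phi>_def image_image flip: strip_log_image[OF a])
    also have "\<dots> = {v. \<alpha> - 1 < Re v \<and> Re v < \<beta> - 1}"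
    proof (intro equalityI subsetI)
      fix v assume "v \<in> {v. \<alpha> - 1 < Re v \<and> Re v < \<beta> - 1}"
      then have "K * (a - pi) < - Re v" "- Re v < K * a" using Ka by auto
      then have "v / (of_real K * \<i>) \<in> {v. a - pi < Im v \<and> Im v < a}"
        using \<open>K > 0\<close> by (simp add: Im_divide field_simps power2_eq_square)
      moreover have "v = of_real K * \<i> * (v / (of_real K * \<i>))" using \<open>K > 0\<close> by simp
      ultimately show "v \<in> (\<lambda>v. of_real K * \<i> * v) ` {v. a - pi < Im v \<and> Im v < a}" by blast
    next
      fix u assume "u \<in> (\<lambda>v. of_real K * \<i> * v) ` {v. a - pi < Im v \<and> Im v < a}"
      then obtain v where "u = of_real K * \<i> * v" "a - pi < Im v" "Im v < a" by blast
      moreover from this have "K * (a - pi) < K * Im v" "K * Im v < K * a"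
        using \<open>K > 0\<close> by auto
      ultimately show "u \<in> {v. \<alpha> - 1 < Re v \<and> Re v < \<beta> - 1}"
        using Ka by simp
    qed
    finally show ?thesis .
  qed
  have \<phi>_convex: "convex (\<phi> ` unit_disc)"
    unfolding \<phi>_image Collect_conj_eq
    by (intro convex_Int convex_halfspace_Re_gt convex_halfspace_Re_lt)

  define \<psi> where "\<psi> = (\<lambda>z. of_real K * \<i> *
    (if z = 0 then deriv (strip_log a) 0 else strip_log a z / z))"
  obtain H where PH: "\<And>z. z \<in> unit_disc \<Longrightarrow> P_hat \<alpha> \<beta> z = H z"
    and H: "\<And>z. z \<in> unit_disc \<Longrightarrow> (H has_field_derivative \<psi> z) (at z)"
    using P_hat_primitive[of \<alpha> \<beta>] unfolding \<psi>_def a_def K_def by metis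
  have h': "(P_hat \<alpha> \<beta> has_field_derivative \<psi> z) (at z)" if "z \<in> unit_disc" for z
    using H[OF that] by (rule has_field_derivative_transform_within_open[OF _ open_ball that]) (simp add: PH)
  have h: "P_hat \<alpha> \<beta> holomorphic_on unit_disc"
    unfolding holomorphic_on_open[OF open_ball] using h' by blast
  have h0: "P_hat \<alpha> \<beta> 0 = 0"
    by (simp add: P_hat_def)
  have h_\<phi>: "z * deriv (P_hat \<alpha> \<beta>) z = \<phi> z" if "z \<in> unit_disc" for z
    using DERIV_imp_deriv[OF h'[OF that]] \<phi>(2) by (simp add: \<psi>_def \<phi>_def)

  have h_inj: "inj_on (P_hat \<alpha> \<beta>) unit_disc"
  \<comment> \<open>Rotation by \<open>cis (- a)\<close> brings the derivative \<psi> into the right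
    half-plane.\<close>
  proof (rule Noshiro_Warschawski[where c = "cis (- a)", OF convex_ball h'])
    fix z :: complex assume z: "z \<in> unit_disc"
    define q where "q = (if z = 0 then deriv (strip_log a) 0 else strip_log a z / z)"
    have "Re (\<i> * cis (- a) * q) > 0"
      using Re_strip_log_quotient_pos[OF a z] Re_deriv_strip_log_0_pos[OF a]
      unfolding q_def by presburger
    moreover have "Re (of_real K * x) = K * Re x" for x
      by simp
    moreover have "cis (- a) * \<psi> z = of_real K * (\<i> * cis (- a) * q)"
      by (simp add: \<psi>_def q_def)
    ultimately show "Re (cis (- a) * \<psi> z) > 0"
      using \<open>K > 0\<close> mult_pos_pos by metis
  qed

  note G = log_f_over_z[OF assms(4)]
  have "log_f_over_z f ` unit_disc \<subseteq> P_hat \<alpha> \<beta> ` unit_disc"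
  proof (rule Suffridge_image_subset[OF \<phi>(1) \<phi>_inj \<phi>_convex \<phi>(2) h h_inj h_\<phi> G(1)])
    show "z * deriv (log_f_over_z f) z \<in> \<phi> ` unit_disc" if "z \<in> unit_disc" for z
      using assms(4) that G(3)[OF that] by (simp add: \<phi>_image class_S_def)
  qed (auto simp: G h0)
  then have "log_f_over_z f \<prec> P_hat \<alpha> \<beta>"
    using G h0 by (intro subordinate_univalentI[OF h h_inj]) auto
  moreover have "convex (P_hat \<alpha> \<beta> ` unit_disc)"
    using convex_image_of_convex_derivative[OF \<phi>(1) \<phi>_inj \<phi>_convex \<phi>(2) h h_inj h_\<phi>] .
  ultimately show ?thesis
    unfolding convex_univalent_def using h h_inj by blast
qed

end
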